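(* Let $(X,A,m,\alpha)$ be a micro-macro system and let $(A,\to)$ be its directed graph of reproducible transitions. Then $(A,\to)$ is a disjoint union of directed cycles (including possibly loops $a\to a$) and rooted trees, with all edges of each tree directed towards its root (a macrostate with no outgoing edge). The entropy $S$ is constant on each cycle, and entropy increases (i.e. $S(a)\le S(b)$ for every edge $a\to b$) along paths towards the roots.
   Context: A micro-macro system $(X,A,m,\alpha)$ consists of finite sets $X$ and $A$, a bijection $\alpha:X\to X$ and a surjection $m:X\to A$; a macrostate $a$ is identified with the subset $m^{-1}(a)\subseteq X$ and $|a|=|m^{-1}(a)|$, $S(a)=\ln|a|$. A transition $a\to b$ between macrostates is reproducible if $\alpha(a)\subseteq b$, i.e. $\alpha(i)\in b$ for all $i\in a$. The graph $(A,\to)$ has vertex set $A$ and an edge $a\to b$ for each reproducible transition. *)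

theory Defs
  imports Complex_Main "Graph_Theory.Digraph_Component"
begin

locale micro_macro_system =
  fixes X :: "'x set" and A :: "'a set" and m :: "'x \<Rightarrow> 'a" and \<alpha> :: "'x \<Rightarrow> 'x"
  assumes finite_micro: "finite X"
    and finite_macro: "finite A"
    and m_surj: "m ` X = A"
    and \<alpha>_bij: "bij_betw \<alpha> X X"

definition macrostate :: "'x set \<Rightarrow> ('x \<Rightarrow> 'a) \<Rightarrow> 'a \<Rightarrow> 'x set" where
  "macrostate X m a = {i \<in> X. m i = a}"

definition entropy :: "'x set \<Rightarrow> ('x \<Rightarrow> 'a) \<Rightarrow> 'a \<Rightarrow> real" where
  "entropy X m a = ln (real (card (macrostate X m a)))"

definition reproducible :: "'x set \<Rightarrow> ('x \<Rightarrow> 'a) \<Rightarrow> ('x \<Rightarrow> 'x) \<Rightarrow> 'a \<Rightarrow> 'a \<Rightarrow> bool" where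
  "reproducible X m \<alpha> a b \<longleftrightarrow> \<alpha> ` macrostate X m a \<subseteq> macrostate X m b"

definition transition_graph ::
    "'x set \<Rightarrow> 'a set \<Rightarrow> ('x \<Rightarrow> 'a) \<Rightarrow> ('x \<Rightarrow> 'x) \<Rightarrow> 'a pair_pre_digraph" where
  "transition_graph X A m \<alpha> =
    \<lparr> pverts = A, parcs = {(a, b). a \<in> A \<and> b \<in> A \<and> reproducible X m \<alpha> a b} \<rparr>"

definition disjoint_union_of :: "'a pair_pre_digraph \<Rightarrow> 'a pair_pre_digraph set \<Rightarrow> bool" where
  "disjoint_union_of G \<H> \<longleftrightarrow>
    pairwise (\<lambda>H K. disjnt (pverts H) (pverts K)) \<H> \<and>
    pverts G = (\<Union>H\<in>\<H>. pverts H) \<and> parcs G = (\<Union>H\<in>\<H>. parcs H)"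

text \<open>A library cycle is a nonempty closed walk without repeated vertices, so it may be a loop
  or have length two.\<close>

definition directed_cycle :: "'a pair_pre_digraph \<Rightarrow> bool" where
  "directed_cycle C \<longleftrightarrow>
    (\<exists>p. pre_digraph.cycle (with_proj C) p \<and> parcs C = set p \<and> pverts C = fst ` set p)"

text \<open>The predicate \<^const>\<open>Digraph_Component.tree\<close> only excludes directed cycles.
  Here the underlying undirected graph is required to be a tree. Asymmetry excludes loops and pairs
  of antiparallel arcs; a cycle of length two in the symmetrization just runs through one
  undirected edge back and forth.\<close>

definition undirected_tree :: "'a pair_pre_digraph \<Rightarrow> bool" where
  "undirected_tree T \<longleftrightarrow>
    pair_wf_digraph T \<and> asym (parcs T) \<and> Digraph_Component.connected (with_proj T) \<and>
    \<not> (\<exists>p. pre_digraph.cycle (with_proj (mk_symmetric (with_proj T))) p \<and> 3 \<le> length p)"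

text \<open>An arc \<open>(u, v)\<close> is directed towards the root \<open>r\<close> if the path from \<open>u\<close> to \<open>r\<close> in the
  underlying undirected tree starts with the step from \<open>u\<close> to \<open>v\<close>.\<close>

definition rooted_tree_towards :: "'a pair_pre_digraph \<Rightarrow> 'a \<Rightarrow> bool" where
  "rooted_tree_towards T r \<longleftrightarrow>
    undirected_tree T \<and> r \<in> pverts T \<and>
    (\<forall>(u, v) \<in> parcs T.
      \<exists>p. pre_digraph.apath (with_proj (mk_symmetric (with_proj T))) u ((u, v) # p) r)"

end

theory Submission
  imports Defs
begin

text \<open>In a finite relation every vertex reaches a recurrent one, that is, a vertex \<open>t\<close> reachable from
  everything \<open>t\<close> reaches. If the relation is single-valued, the recurrent vertices reachable from a
  given vertex are mutually reachable, so the graph is the disjoint union of the basins of its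
  recurrent vertices. The basin of a sink is a tree with all arcs towards the sink.

  Macrostates are nonempty and \<open>\<alpha>\<close> is injective, so reproducible transitions are single-valued and
  do not decrease the size of a macrostate. Hence on a cycle \<open>\<alpha>\<close> maps each macrostate onto the next
  one, and a macrostate outside the cycle cannot lead into it, since its image would meet that of
  the predecessor on the cycle. So the basin of a recurrent vertex that is not a sink is a cycle.\<close>

section \<open>Cycles in digraphs\<close>

context pre_digraph
begin

lemma cas_map_head: "cas u p v \<Longrightarrow> u # map (head G) p = map (tail G) p @ [v]"
  by (induction p arbitrary: u) auto

lemma cycle_subset_arcs: "cycle p \<Longrightarrow> set p \<subseteq> arcs G"
  by (auto simp: cycle_def awalk_def)

lemma cycle_map_head:
  assumes "cycle p"
  shows "map (head G) p = rotate1 (map (tail G) p)"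
proof -
  obtain u where "cas u p u" and "p \<noteq> []"
    using assms by (auto simp: cycle_def awalk_def)
  then show ?thesis
    using cas_map_head by (cases p) fastforce+
qed

lemma cycle_distinct_tails:
  assumes "cycle p"
  shows "distinct (map (tail G) p)"
proof -
  obtain u where "cas u p u" and "distinct (tl (awalk_verts u p))" and "p \<noteq> []"
    using assms by (auto simp: cycle_def awalk_def)
  then have "distinct (map (head G) p)"
    by (simp add: awalk_verts_conv')
  then show ?thesis
    by (simp add: cycle_map_head[OF assms])
qed

lemma cycle_head_image:
  assumes "cycle p"
  shows "head G ` set p = tail G ` set p"
  using arg_cong[OF cycle_map_head[OF assms], of set] by simp

lemma cycle_head_nth:
  assumes "cycle p" and "i < length p"
  shows "head G (p ! i) = tail G (p ! (Suc i mod length p))"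
proof -
  have "map (head G) p ! i = map (tail G) p ! (Suc i mod length p)"
    using assms(2) by (simp add: cycle_map_head[OF assms(1)] nth_rotate1)
  moreover have "Suc i mod length p < length p"
    using assms(2) by (intro mod_less_divisor) linarith
  ultimately show ?thesis
    using assms(2) by simp
qed

lemma cycle_distinct_neighbours:
  assumes "cycle p" and "3 \<le> length p" and "v \<in> tail G ` set p"
  obtains e f where "e \<in> set p" and "f \<in> set p" and "head G e = v" and "tail G f = v"
    and "tail G e \<noteq> head G f"
proof -
  let ?n = "length p"
  have "v \<in> head G ` set p"
    using assms(1,3) by (simp add: cycle_head_image)
  then obtain i where i: "i < ?n" "head G (p ! i) = v"
    by (metis imageE in_set_conv_nth)
  define j where "j = Suc i mod ?n"
  define k where "k = Suc j mod ?n"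
  have j: "j < ?n" and k: "k < ?n"
    using i(1) unfolding j_def k_def by (auto intro!: mod_less_divisor)
  have "i \<noteq> k"
    using i(1) assms(2) by (auto simp: j_def k_def mod_Suc)
  then have "tail G (p ! i) \<noteq> tail G (p ! k)"
    using nth_eq_iff_index_eq[OF cycle_distinct_tails[OF assms(1)], of i k] i(1) k by simp
  moreover have "head G (p ! j) = tail G (p ! k)"
    unfolding k_def by (rule cycle_head_nth[OF assms(1) j])
  moreover have "tail G (p ! j) = v"
    using cycle_head_nth[OF assms(1) i(1)] i(2) by (simp add: j_def)
  ultimately show thesis
    using that[of "p ! i" "p ! j"] i j by simp
qed

end

lemma (in pair_wf_digraph) single_valued_cycle_closed:
  assumes "single_valued (parcs G)" and "cycle p"
    and "v \<in> fst ` set p" and "(v, w) \<in> parcs G"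
  shows "(v, w) \<in> set p"
proof -
  obtain w' where w': "(v, w') \<in> set p"
    using assms(3) by fastforce
  moreover have "set p \<subseteq> parcs G"
    using assms(2) by (rule cycle_subset_arcs)
  ultimately have "w' = w"
    using assms(1,4) by (meson single_valuedD subsetD)
  then show ?thesis
    using w' by simp
qed

lemma (in pair_wf_digraph) cycle_through_arc:
  assumes "(a, b) \<in> parcs G" and "b \<rightarrow>\<^sup>*\<^bsub>G\<^esub> a"
  obtains p where "cycle ((a, b) # p)"
proof -
  obtain p where p: "apath b p a"
    using assms(2) by (auto simp: reachable_apath)
  have "awalk a ((a, b) # p) a"
    using p assms(1) in_arcsD1 by (simp add: apath_def awalk_Cons_iff)
  moreover have "distinct (tl (pawalk_verts a ((a, b) # p)))"
    using p by (simp add: apath_def)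
  ultimately show thesis
    using that unfolding cycle_def by blast
qed

lemma (in pair_wf_digraph) directed_cycleI:
  assumes sv: "single_valued (parcs G)" and sc: "strongly_connected (with_proj G)"
    and "parcs G \<noteq> {}"
  shows "directed_cycle G"
proof -
  obtain a b where ab: "(a, b) \<in> parcs G"
    using assms(3) by auto
  then have "b \<rightarrow>\<^sup>*\<^bsub>G\<^esub> a"
    using sc in_arcsD1 in_arcsD2 by (auto simp: strongly_connected_def)
  then obtain q where cycle: "cycle q" and a: "a \<in> fst ` set q"
    using cycle_through_arc[OF ab] by (metis fst_conv image_eqI list.set_intros(1))
  note closed = single_valued_cycle_closed[OF sv cycle]
  have on_cycle: "v \<in> fst ` set q" if "v \<in> pverts G" for v
  proof -
    have "a \<rightarrow>\<^sup>*\<^bsub>G\<^esub> v"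
      using sc that ab in_arcsD1 by (auto simp: strongly_connected_def)
    then show ?thesis
    proof (induction rule: reachable_induct)
      case base
      show ?case by (rule a)
    next
      case (step v w)
      then have "(v, w) \<in> set q"
        by (intro closed) simp_all
      then have "w \<in> snd ` set q"
        by force
      then show ?case
        using cycle_head_image[OF cycle] by simp
    qed
  qed
  have arcs: "set q \<subseteq> parcs G"
    using cycle by (rule cycle_subset_arcs)
  have "parcs G = set q"
    using arcs on_cycle closed in_arcsD1 by auto
  moreover have "pverts G = fst ` set q"
    using arcs on_cycle in_arcsD1 by auto
  ultimately show ?thesis
    using cycle unfolding directed_cycle_def by blast
qed

section \<open>Rooted trees\<close>

text \<open>A vertex of a long undirected cycle without predecessor on the cycle would have both its
  neighbours as successors.\<close>

lemma length_undirected_cycle_less_3: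
  assumes sv: "single_valued (parcs T)" and "acyclic (parcs T)"
    and cycle: "pre_digraph.cycle (with_proj (mk_symmetric (with_proj T))) p"
  shows "length p < 3"
proof (rule ccontr)
  assume "\<not> length p < 3"
  then have len: "3 \<le> length p" by simp
  interpret S: pair_pre_digraph "mk_symmetric (with_proj T)" .
  let ?V = "fst ` set p"
  have arc: "e \<in> parcs T \<or> (snd e, fst e) \<in> parcs T" if "e \<in> set p" for e
    using S.cycle_subset_arcs[OF cycle] that by (fastforce simp: parcs_mk_symmetric)
  have "wf (parcs T \<inter> ?V \<times> ?V)"
    using assms(2) by (intro finite_acyclic_wf) (auto intro: acyclic_subset)
  moreover have "?V \<noteq> {}"
    using len by auto
  ultimately obtain v where v: "v \<in> ?V"
      and "\<And>w. (w, v) \<in> parcs T \<inter> ?V \<times> ?V \<Longrightarrow> w \<notin> ?V"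
    by (rule wfE_min') (rule that)
  then have no_pred: "(w, v) \<notin> parcs T" if "w \<in> ?V" for w
    using that by blast
  obtain e f where e: "e \<in> set p" "snd e = v" and f: "f \<in> set p" "fst f = v"
      and ef: "fst e \<noteq> snd f"
    using S.cycle_distinct_neighbours[OF cycle len v] .
  have "snd f \<in> ?V"
    using f(1) S.cycle_head_image[OF cycle] by blast
  then have "(v, snd f) \<in> parcs T"
    using arc[OF f(1)] f(2) no_pred by auto
  moreover have "(v, fst e) \<in> parcs T"
    using arc[OF e(1)] e no_pred[of "fst e"] by (metis imageI prod.collapse)
  ultimately show False
    using sv ef by (meson single_valuedD)
qed

lemma (in pair_wf_digraph) connected_if_all_reach:
  assumes "r \<in> pverts G" and "\<And>v. v \<in> pverts G \<Longrightarrow> v \<rightarrow>\<^sup>*\<^bsub>G\<^esub> r"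
  shows "Digraph_Component.connected (with_proj G)"
  unfolding connected_def
proof (rule strongly_connectedI)
  interpret S: pair_wf_digraph "mk_symmetric (with_proj G)"
    by (rule wellformed_mk_symmetric)
  show "verts (with_proj (mk_symmetric (with_proj G))) \<noteq> {}"
    using assms(1) by auto
  fix u v
  assume "u \<in> verts (with_proj (mk_symmetric (with_proj G)))"
    and "v \<in> verts (with_proj (mk_symmetric (with_proj G)))"
  then have "u \<rightarrow>\<^sup>*\<^bsub>mk_symmetric G\<^esub> r" and "v \<rightarrow>\<^sup>*\<^bsub>mk_symmetric G\<^esub> r"
    using assms(2) reachable_mk_symmetricI by auto
  then show "u \<rightarrow>\<^sup>*\<^bsub>mk_symmetric G\<^esub> v"
    using symmetric_reachable[OF symmetric_mk_symmetric] S.reachable_trans by metis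
qed

lemma (in pair_wf_digraph) acyclic_apath_through_arc:
  assumes "acyclic (parcs G)" and "(u, v) \<in> parcs G" and "v \<rightarrow>\<^sup>*\<^bsub>G\<^esub> r"
  obtains p where "apath u ((u, v) # p) r"
proof -
  obtain p where p: "apath v p r"
    using assms(3) by (auto simp: reachable_apath)
  have "u \<notin> set (pawalk_verts v p)"
  proof
    assume "u \<in> set (pawalk_verts v p)"
    then have "v \<rightarrow>\<^sup>*\<^bsub>G\<^esub> u"
      using p awalk_verts_reachable_from awalkI_apath by blast
    then have "(v, u) \<in> (parcs G)\<^sup>*"
      by (simp add: reachable_conv)
    then show False
      using assms(1,2) by (meson acyclic_def rtrancl_into_trancl2)
  qed
  then show thesis
    using p assms(2) that by (simp add: apath_Cons_iff)
qed

lemma (in pair_wf_digraph) apath_mk_symmetric: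
  assumes "apath u p v"
  shows "pre_digraph.apath (with_proj (mk_symmetric (with_proj G))) u p v"
proof -
  interpret S: pair_wf_digraph "mk_symmetric (with_proj G)"
    by (rule wellformed_mk_symmetric)
  have "parcs G \<subseteq> parcs (mk_symmetric (with_proj G))"
    by (force simp: parcs_mk_symmetric)
  then show ?thesis
    using assms by (auto simp: S.apath_def apath_def S.awalk_def awalk_def)
qed

lemma not_cyclic_if_reaches_sink:
  assumes "single_valued R" and "(v, r) \<in> R\<^sup>*" and "r \<notin> Domain R"
  shows "(v, v) \<notin> R\<^sup>+"
  using assms(2)
proof (induction rule: converse_rtrancl_induct)
  case base
  show ?case
    using assms(3) by (meson DomainI tranclD)
next
  case (step u v)
  show ?case
  proof
    assume "(u, u) \<in> R\<^sup>+"
    then obtain w where "(u, w) \<in> R" "(w, u) \<in> R\<^sup>*"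
      by (meson tranclD)
    then have "(v, u) \<in> R\<^sup>*"
      using assms(1) step.hyps(1) by (metis single_valuedD)
    then show False
      using step by (meson rtrancl_into_trancl1)
  qed
qed

lemma (in pair_wf_digraph) rooted_tree_towardsI:
  assumes sv: "single_valued (parcs G)" and root: "r \<in> pverts G" "r \<notin> Domain (parcs G)"
    and reach: "\<And>v. v \<in> pverts G \<Longrightarrow> v \<rightarrow>\<^sup>*\<^bsub>G\<^esub> r"
  shows "rooted_tree_towards G r"
proof -
  have acyclic: "acyclic (parcs G)"
  proof (rule acyclicI, intro allI notI)
    fix v assume cyclic: "(v, v) \<in> (parcs G)\<^sup>+"
    then have "v \<in> pverts G"
      by (meson in_arcsD1 tranclD)
    then have "(v, r) \<in> (parcs G)\<^sup>*"
      using reach by (simp add: reachable_conv)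
    then show False
      using not_cyclic_if_reaches_sink[OF sv _ root(2)] cyclic by blast
  qed
  then have "asym (parcs G)"
    by (intro asymI) (meson acyclic_def r_into_trancl trancl_trans)
  then have "undirected_tree G"
    using connected_if_all_reach[OF root(1) reach] length_undirected_cycle_less_3[OF sv acyclic]
      pair_wf_digraph_axioms
    unfolding undirected_tree_def by (meson not_less)
  moreover have "\<exists>p. pre_digraph.apath (with_proj (mk_symmetric (with_proj G))) u ((u, v) # p) r"
    if "(u, v) \<in> parcs G" for u v
    using acyclic_apath_through_arc[OF acyclic that reach] apath_mk_symmetric in_arcsD2 that
    by metis
  ultimately show ?thesis
    using root(1) unfolding rooted_tree_towards_def by blast
qed

section \<open>Basins of recurrent vertices\<close>

definition recurrent :: "'a rel \<Rightarrow> 'a set" where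
  "recurrent R = {t. \<forall>v. (t, v) \<in> R\<^sup>* \<longrightarrow> (v, t) \<in> R\<^sup>*}"

definition basin :: "'a rel \<Rightarrow> 'a \<Rightarrow> 'a pair_pre_digraph" where
  "basin R t = \<lparr> pverts = {v. (v, t) \<in> R\<^sup>*}, parcs = {(u, v) \<in> R. (v, t) \<in> R\<^sup>*} \<rparr>"

lemma recurrentD: "t \<in> recurrent R \<Longrightarrow> (t, v) \<in> R\<^sup>* \<Longrightarrow> (v, t) \<in> R\<^sup>*"
  by (simp add: recurrent_def)

lemma finite_reaches_recurrent:
  assumes "finite R"
  obtains t where "(v, t) \<in> R\<^sup>*" and "t \<in> recurrent R"
proof -
  let ?reach = "\<lambda>u. R\<^sup>* `` {u}"
  obtain t where t: "(v, t) \<in> R\<^sup>*"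
      and least: "\<And>u. (v, u) \<in> R\<^sup>* \<Longrightarrow> card (?reach t) \<le> card (?reach u)"
    using ex_has_least_nat[of "\<lambda>u. (v, u) \<in> R\<^sup>*" v "\<lambda>u. card (?reach u)"] by blast
  have "(u, t) \<in> R\<^sup>*" if "(t, u) \<in> R\<^sup>*" for u
  proof -
    have "?reach u \<subseteq> ?reach t"
      using that by (auto intro: rtrancl_trans)
    moreover have "card (?reach t) \<le> card (?reach u)"
      using t that by (intro least) (rule rtrancl_trans)
    ultimately have "?reach u = ?reach t"
      using assms by (intro card_seteq) simp_all
    then show ?thesis by blast
  qed
  then show thesis
    using that t by (simp add: recurrent_def)
qed

lemma pverts_basin_iff [simp]: "v \<in> pverts (basin R t) \<longleftrightarrow> (v, t) \<in> R\<^sup>*"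
  by (simp add: basin_def)

lemma parcs_basin_iff [simp]: "(u, v) \<in> parcs (basin R t) \<longleftrightarrow> (u, v) \<in> R \<and> (v, t) \<in> R\<^sup>*"
  by (simp add: basin_def)

lemma parcs_basin_subset: "parcs (basin R t) \<subseteq> R"
  by auto

lemma pair_wf_digraph_basin: "pair_wf_digraph (basin R t)"
  by unfold_locales (auto intro: converse_rtrancl_into_rtrancl)

lemma reachable_basin:
  assumes "(u, v) \<in> R\<^sup>*" and "(v, t) \<in> R\<^sup>*"
  shows "u \<rightarrow>\<^sup>*\<^bsub>basin R t\<^esub> v"
proof -
  interpret B: pair_wf_digraph "basin R t"
    by (rule pair_wf_digraph_basin)
  show ?thesis
    using assms(1)
  proof (induction rule: converse_rtrancl_induct)
    case base
    show ?case using assms(2) by simp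
  next
    case (step u w)
    then have "(u, w) \<in> parcs (basin R t)"
      using assms(2) by (auto intro: rtrancl_trans)
    then show ?case
      using step.IH by (rule B.adj_reachable_trans)
  qed
qed

lemma basin_eq_if_common_vertex:
  assumes "single_valued R" and st: "s \<in> recurrent R" "t \<in> recurrent R"
    and "(v, s) \<in> R\<^sup>*" and "(v, t) \<in> R\<^sup>*"
  shows "basin R s = basin R t"
proof -
  have "(s, t) \<in> R\<^sup>*" and "(t, s) \<in> R\<^sup>*"
    using single_valued_confluent[OF assms(1,4,5)] st recurrentD by metis+
  then have "(u, s) \<in> R\<^sup>* \<longleftrightarrow> (u, t) \<in> R\<^sup>*" for u
    by (meson rtrancl_trans)
  then show ?thesis
    by (simp add: basin_def)
qed

lemma pairwise_disjnt_basins: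
  assumes "single_valued R"
  shows "pairwise (\<lambda>H K. disjnt (pverts H) (pverts K)) (basin R ` recurrent R)"
proof (rule pairwiseI)
  fix H K assume "H \<in> basin R ` recurrent R" and "K \<in> basin R ` recurrent R" and "H \<noteq> K"
  then obtain s t where st: "s \<in> recurrent R" "t \<in> recurrent R" "basin R s \<noteq> basin R t"
      and HK: "H = basin R s" "K = basin R t"
    by blast
  have "(v, s) \<notin> R\<^sup>* \<or> (v, t) \<notin> R\<^sup>*" for v
    using basin_eq_if_common_vertex[OF assms st(1,2)] st(3) by metis
  then show "disjnt (pverts H) (pverts K)"
    by (simp add: HK disjnt_iff)
qed

lemma disjoint_union_of_basins:
  assumes "pair_wf_digraph G" and "finite (parcs G)" and sv: "single_valued (parcs G)"
  shows "disjoint_union_of G (basin (parcs G) ` (pverts G \<inter> recurrent (parcs G)))"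
proof -
  interpret G: pair_wf_digraph G by fact
  let ?R = "parcs G"
  let ?\<B> = "basin ?R ` (pverts G \<inter> recurrent ?R)"
  have verts_forward: "v \<in> pverts G" if "(u, v) \<in> ?R\<^sup>*" "u \<in> pverts G" for u v
    using that by (induction rule: rtrancl_induct) (auto dest: G.in_arcsD2)
  have verts_backward: "u \<in> pverts G" if "(u, v) \<in> ?R\<^sup>*" "v \<in> pverts G" for u v
    using that by (induction rule: converse_rtrancl_induct) (auto dest: G.in_arcsD1)
  have covered: "\<exists>B\<in>?\<B>. v \<in> pverts B" if "v \<in> pverts G" for v
  proof -
    obtain t where "(v, t) \<in> ?R\<^sup>*" and "t \<in> recurrent ?R"
      using finite_reaches_recurrent[OF assms(2)] .
    then show ?thesis
      using verts_forward that by (intro bexI[of _ "basin ?R t"]) simp_all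
  qed
  have "pairwise (\<lambda>H K. disjnt (pverts H) (pverts K)) ?\<B>"
    using pairwise_disjnt_basins[OF sv] by (rule pairwise_subset) blast
  moreover have "pverts G = (\<Union>B\<in>?\<B>. pverts B)"
  proof
    show "(\<Union>B\<in>?\<B>. pverts B) \<subseteq> pverts G"
      by (auto dest: verts_backward)
  qed (use covered in blast)
  moreover have "?R = (\<Union>B\<in>?\<B>. parcs B)"
  proof
    show "?R \<subseteq> (\<Union>B\<in>?\<B>. parcs B)"
    proof (rule subrelI)
      fix u v assume uv: "(u, v) \<in> ?R"
      then obtain B where "B \<in> ?\<B>" and "v \<in> pverts B"
        using covered G.in_arcsD2 by meson
      then have "(u, v) \<in> parcs B"
        using uv by auto
      then show "(u, v) \<in> (\<Union>B\<in>?\<B>. parcs B)"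
        using \<open>B \<in> ?\<B>\<close> by (rule UN_I[rotated])
    qed
  qed auto
  ultimately show ?thesis
    unfolding disjoint_union_of_def by blast
qed

lemma rooted_tree_towards_basin:
  assumes "single_valued R" and "r \<notin> Domain R"
  shows "rooted_tree_towards (basin R r) r"
proof -
  interpret B: pair_wf_digraph "basin R r"
    by (rule pair_wf_digraph_basin)
  show ?thesis
  proof (rule B.rooted_tree_towardsI)
    show "single_valued (parcs (basin R r))"
      using parcs_basin_subset assms(1) by (rule single_valued_subset)
    show "r \<notin> Domain (parcs (basin R r))"
      using assms(2) by auto
  qed (simp_all add: reachable_basin)
qed

lemma strongly_connected_basin:
  assumes "t \<in> recurrent R" and "t \<in> Domain R"
    and unique_pred: "\<And>a b c. (b, a) \<in> R \<Longrightarrow> (a, b) \<in> R\<^sup>* \<Longrightarrow> (c, a) \<in> R \<Longrightarrow> b = c"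
  shows "strongly_connected (with_proj (basin R t))"
proof -
  have cyclic: "(t, t) \<in> R\<^sup>+"
    using assms(1,2) recurrentD by (metis DomainE r_into_rtrancl rtrancl_into_trancl2)
  have from_t: "(t, v) \<in> R\<^sup>*" if "(v, t) \<in> R\<^sup>*" for v
    using that
  proof (induction rule: converse_rtrancl_induct)
    case (step u v)
    have "(t, v) \<in> R\<^sup>+"
      using cyclic step.IH by (rule trancl_rtrancl_trancl)
    then obtain b where b: "(t, b) \<in> R\<^sup>*" "(b, v) \<in> R"
      by (meson tranclD2)
    have "(v, b) \<in> R\<^sup>*"
      using step.hyps(2) b(1) by (rule rtrancl_trans)
    then have "b = u"
      using unique_pred b(2) step.hyps(1) by blast
    then show ?case
      using b(1) by simp
  qed simp
  show ?thesis
  proof (rule strongly_connectedI)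
    show "verts (with_proj (basin R t)) \<noteq> {}"
      by (auto simp: basin_def)
    fix u v assume "u \<in> verts (with_proj (basin R t))" and "v \<in> verts (with_proj (basin R t))"
    then show "u \<rightarrow>\<^sup>*\<^bsub>basin R t\<^esub> v"
      using from_t by (intro reachable_basin) (auto intro: rtrancl_trans)
  qed
qed

lemma directed_cycle_basin:
  assumes "single_valued R" and "t \<in> recurrent R" and "t \<in> Domain R"
    and "strongly_connected (with_proj (basin R t))"
  shows "directed_cycle (basin R t)"
proof (rule pair_wf_digraph.directed_cycleI[OF pair_wf_digraph_basin])
  show "single_valued (parcs (basin R t))"
    using parcs_basin_subset assms(1) by (rule single_valued_subset)
  obtain v where "(t, v) \<in> R"
    using assms(3) by blast
  then have "(t, v) \<in> parcs (basin R t)"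
    using assms(2) by (auto intro: recurrentD)
  then show "parcs (basin R t) \<noteq> {}" by blast
qed fact

section \<open>Reproducible transitions\<close>

context micro_macro_system
begin

abbreviation transitions :: "'a rel" where
  "transitions \<equiv> parcs (transition_graph X A m \<alpha>)"

lemma transitions_iff:
  "(a, b) \<in> transitions \<longleftrightarrow> a \<in> A \<and> b \<in> A \<and> \<alpha> ` macrostate X m a \<subseteq> macrostate X m b"
  by (simp add: transition_graph_def reproducible_def)

lemma finite_macrostate: "finite (macrostate X m a)"
  using finite_micro by (simp add: macrostate_def)

lemma macrostate_nonempty: "a \<in> A \<Longrightarrow> macrostate X m a \<noteq> {}"
  using m_surj by (auto simp: macrostate_def)

lemma card_image_macrostate: "card (\<alpha> ` macrostate X m a) = card (macrostate X m a)"
  using \<alpha>_bij by (intro card_image) (auto simp: bij_betw_def macrostate_def intro: inj_on_subset)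

lemma pair_fin_digraph_transition_graph: "pair_fin_digraph (transition_graph X A m \<alpha>)"
proof -
  have "transitions \<subseteq> A \<times> A"
    by (auto simp: transitions_iff)
  then have "finite transitions"
    using finite_macro by (meson finite_SigmaI finite_subset)
  then show ?thesis
    using finite_macro by unfold_locales (auto simp: transition_graph_def)
qed

lemma single_valued_transitions: "single_valued transitions"
proof (rule single_valuedI)
  fix a b c assume ab: "(a, b) \<in> transitions" and ac: "(a, c) \<in> transitions"
  obtain i where "i \<in> macrostate X m a"
    using ab macrostate_nonempty by (auto simp: transitions_iff)
  then have "\<alpha> i \<in> macrostate X m b" "\<alpha> i \<in> macrostate X m c"
    using ab ac by (auto simp: transitions_iff)
  then show "b = c" by (simp add: macrostate_def)
qed

lemma card_macrostate_mono:
  assumes "(a, b) \<in> transitions\<^sup>*"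
  shows "card (macrostate X m a) \<le> card (macrostate X m b)"
  using assms
proof (induction rule: rtrancl_induct)
  case (step b c)
  have "card (macrostate X m b) = card (\<alpha> ` macrostate X m b)"
    by (rule card_image_macrostate[symmetric])
  also have "\<dots> \<le> card (macrostate X m c)"
    using step.hyps(2) finite_macrostate by (intro card_mono) (auto simp: transitions_iff)
  finally show ?case
    using step.IH by simp
qed simp

lemma entropy_mono:
  assumes "(a, b) \<in> transitions\<^sup>*" and "a \<in> A"
  shows "entropy X m a \<le> entropy X m b"
proof -
  have "0 < card (macrostate X m a)"
    using assms(2) finite_macrostate macrostate_nonempty by (simp add: card_gt_0_iff)
  then show ?thesis
    using card_macrostate_mono[OF assms(1)] by (simp add: entropy_def)
qed

lemma entropy_eq_if_strongly_connected:
  assumes "strongly_connected (with_proj C)" and "parcs C \<subseteq> transitions"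
    and "a \<in> pverts C" and "b \<in> pverts C"
  shows "entropy X m a = entropy X m b"
proof -
  have "(u, v) \<in> transitions\<^sup>*" if "u \<in> pverts C" and "v \<in> pverts C" for u v
  proof -
    have "(u, v) \<in> (parcs C)\<^sup>*"
      using assms(1) that reachable_rtranclI[of "with_proj C" u v]
      by (simp add: strongly_connected_def)
    then show ?thesis
      using rtrancl_mono[OF assms(2)] by blast
  qed
  then have "card (macrostate X m a) = card (macrostate X m b)"
    using assms(3,4) by (intro le_antisym card_macrostate_mono)
  then show ?thesis
    by (simp add: entropy_def)
qed

lemma cycle_predecessor_unique:
  assumes ba: "(b, a) \<in> transitions" and ab: "(a, b) \<in> transitions\<^sup>*"
    and ca: "(c, a) \<in> transitions"
  shows "b = c"
proof -
  have "card (macrostate X m a) \<le> card (\<alpha> ` macrostate X m b)"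
    using card_macrostate_mono[OF ab] by (simp add: card_image_macrostate)
  then have onto: "\<alpha> ` macrostate X m b = macrostate X m a"
    using ba finite_macrostate by (intro card_seteq) (auto simp: transitions_iff)
  obtain i where i: "i \<in> macrostate X m c"
    using ca macrostate_nonempty by (auto simp: transitions_iff)
  then have "\<alpha> i \<in> \<alpha> ` macrostate X m b"
    using ca onto by (auto simp: transitions_iff)
  then obtain j where j: "j \<in> macrostate X m b" "\<alpha> i = \<alpha> j" by blast
  then have "i = j"
    using i \<alpha>_bij by (auto simp: macrostate_def bij_betw_def dest: inj_onD)
  then show "b = c"
    using i j(1) by (simp add: macrostate_def)
qed

lemma
  assumes "t \<in> recurrent transitions" and "t \<in> Domain transitions"
  shows directed_cycle_basin_transitions: "directed_cycle (basin transitions t)"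
    and entropy_constant_on_basin:
      "\<lbrakk>a \<in> pverts (basin transitions t); b \<in> pverts (basin transitions t)\<rbrakk>
        \<Longrightarrow> entropy X m a = entropy X m b"
proof -
  have strongly_connected: "strongly_connected (with_proj (basin transitions t))"
    using assms by (rule strongly_connected_basin) (rule cycle_predecessor_unique)
  show "directed_cycle (basin transitions t)"
    using single_valued_transitions assms strongly_connected by (rule directed_cycle_basin)
  show "entropy X m a = entropy X m b"
    if "a \<in> pverts (basin transitions t)" and "b \<in> pverts (basin transitions t)"
    using strongly_connected parcs_basin_subset that by (rule entropy_eq_if_strongly_connected)
qed

end

theorem theorem10:
  fixes X :: "'x set" and A :: "'a set" and m :: "'x \<Rightarrow> 'a" and \<alpha> :: "'x \<Rightarrow> 'x"
  assumes "micro_macro_system X A m \<alpha>"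
  defines "G \<equiv> transition_graph X A m \<alpha>"
  shows "(\<exists>\<C> \<T>. disjoint_union_of G (\<C> \<union> \<T>) \<and>
             (\<forall>C\<in>\<C>. directed_cycle C \<and>
                (\<forall>a\<in>pverts C. \<forall>b\<in>pverts C. entropy X m a = entropy X m b)) \<and>
             (\<forall>T\<in>\<T>. \<exists>r. rooted_tree_towards T r \<and> out_arcs (with_proj G) r = {})) \<and>
         (\<forall>(a, b) \<in> parcs G. entropy X m a \<le> entropy X m b)"
proof -
  interpret micro_macro_system X A m \<alpha> by fact
  interpret G: pair_fin_digraph G
    unfolding G_def by (rule pair_fin_digraph_transition_graph)
  let ?R = "parcs G"
  let ?\<C> = "basin ?R ` (pverts G \<inter> recurrent ?R \<inter> Domain ?R)"
  let ?\<T> = "basin ?R ` (pverts G \<inter> recurrent ?R - Domain ?R)"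
  have sv: "single_valued ?R"
    unfolding G_def by (rule single_valued_transitions)
  have "disjoint_union_of G (?\<C> \<union> ?\<T>)"
    using disjoint_union_of_basins[OF G.pair_wf_digraph_axioms G.pair_finite_arcs sv]
    by (simp add: Int_Diff_Un flip: image_Un)
  moreover have "\<forall>C\<in>?\<C>. directed_cycle C \<and>
      (\<forall>a\<in>pverts C. \<forall>b\<in>pverts C. entropy X m a = entropy X m b)"
    using directed_cycle_basin_transitions entropy_constant_on_basin unfolding G_def by blast
  moreover have "\<forall>T\<in>?\<T>. \<exists>r. rooted_tree_towards T r \<and> out_arcs (with_proj G) r = {}"
    using rooted_tree_towards_basin[OF sv] by (force simp: out_arcs_def)
  moreover have "\<forall>(a, b) \<in> ?R. entropy X m a \<le> entropy X m b"
    unfolding G_def by (auto simp: transitions_iff intro!: entropy_mono)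
  ultimately show ?thesis
    by (intro conjI exI[of _ ?\<C>] exI[of _ ?\<T>])
qed

end
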